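(* Let $a\ge 2$ and $d\ge 1$ be integers and let $(w_n)_{n\ge 0}$ be a sequence of complex numbers. Then $(w_n)_{n\ge 0}$ is oscillating of order $d$ if and only if, for every integer $b\ge 0$, the arithmetic subsequence $(w_{an+b})_{n\ge 0}$ is oscillating of order $d$.
   Context: A sequence of complex numbers $(c_n)_{n\ge 0}$ is oscillating of order $d$ ($d\ge 1$ an integer) if for every real polynomial $P\in\mathbb{R}[x]$ of degree less than or equal to $d$, $$\lim_{N\to\infty}\frac1N\sum_{n=0}^{N-1}c_n e^{2\pi i P(n)}=0.$$ *)

theory Defs
  imports "HOL-Analysis.Analysis" "HOL-Computational_Algebra.Polynomial"
begin

definition oscillating_of_order :: "nat \<Rightarrow> (nat \<Rightarrow> complex) \<Rightarrow> bool" where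
  "oscillating_of_order d c \<longleftrightarrow>
    (\<forall>P :: real poly. degree P \<le> d \<longrightarrow>
      (\<lambda>N. 1 / of_nat N *
        (\<Sum>n<N. c n * exp (2 * of_real pi * \<i> * of_real (poly P (of_nat n)))))
      \<longlonglongrightarrow> 0)"

end

theory Submission
  imports Defs
begin

text \<open>
  Averages along \<^term>\<open>a * n\<close> are averages along all \<^term>\<open>n\<close> weighted by the indicator of
  \<^term>\<open>a dvd n\<close>, which is the mean of the characters \<open>n \<mapsto> e(j n / a)\<close>, \<open>j < a\<close>; since
  \<open>d \<ge> 1\<close>, the linear phases \<open>j n / a\<close> can be absorbed into the polynomial. A shift by
  \<^term>\<open>b\<close> changes each sum only by boundedly many terms. Conversely, a sum over \<open>n < N\<close> splits into
  the residue classes modulo \<^term>\<open>a\<close>, each of which has length at most \<open>N\<close>.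
\<close>

abbreviation e :: "real \<Rightarrow> complex" where
  "e x \<equiv> exp (2 * of_real pi * \<i> * of_real x)"

lemma e_add: "e (x + y) = e x * e y"
  by (simp add: ring_distribs exp_add)

lemma oscillating_of_orderD:
  assumes "oscillating_of_order d c" "degree P \<le> d"
  shows "(\<lambda>N. 1 / of_nat N * (\<Sum>n<N. c n * e (poly P (of_nat n)))) \<longlonglongrightarrow> 0"
  using assms unfolding oscillating_of_order_def by blast

text \<open>Since \<open>1 / N\<close> is at most \<open>C / k N\<close>, the new averages are
  dominated by \<open>C\<close> times the old ones evaluated at \<open>k N\<close>. This covers the
  three changes of length below: \<open>N + b\<close>, \<open>a * N\<close> and the size of a
  residue class.\<close>

lemma average_reindex_tendsto_0:
  fixes S :: "nat \<Rightarrow> complex"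
  assumes S: "(\<lambda>N. 1 / of_nat N * S N) \<longlonglongrightarrow> 0"
    and k: "filterlim k at_top sequentially"
    and le: "\<forall>\<^sub>F N in sequentially. k N \<le> C * N"
  shows "(\<lambda>N. 1 / of_nat N * S (k N)) \<longlonglongrightarrow> 0"
proof (rule Lim_null_comparison)
  have lim: "(\<lambda>N. 1 / of_nat (k N) * S (k N)) \<longlonglongrightarrow> 0"
    using filterlim_compose[OF S k] .
  show "(\<lambda>N. real C * norm (1 / of_nat (k N) * S (k N))) \<longlonglongrightarrow> 0"
    by (intro tendsto_mult_right_zero tendsto_norm_zero lim)
  \<comment> \<open>At \<open>k N = 0\<close> division by zero would make the dominating term
    vanish, so such \<open>N\<close> have to be excluded.\<close>
  have "\<forall>\<^sub>F N in sequentially. k N \<ge> 1"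
    using k by (auto simp: filterlim_at_top)
  then show "\<forall>\<^sub>F N in sequentially. norm (1 / of_nat N * S (k N))
      \<le> real C * norm (1 / of_nat (k N) * S (k N))"
    using le eventually_gt_at_top[of 0]
  proof eventually_elim
    case (elim N)
    have "real (k N) \<le> real C * real N"
      using elim(2) by (metis of_nat_le_iff of_nat_mult)
    then have "1 / real N \<le> real C / real (k N)"
      using elim by (simp add: divide_simps mult.commute)
    then have "1 / real N * norm (S (k N)) \<le> real C / real (k N) * norm (S (k N))"
      by (intro mult_right_mono) auto
    then show ?case
      by (simp add: norm_mult norm_divide)
  qed
qed

lemma degree_pcompose_linear_le: "degree (pcompose P [:u, v:]) \<le> degree (P :: real poly)"
  by (rule order.trans[OF degree_pcompose_le]) auto

lemma oscillating_of_order_shift: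
  assumes w: "oscillating_of_order d w"
  shows "oscillating_of_order d (\<lambda>n. w (n + b))"
  unfolding oscillating_of_order_def
proof (intro allI impI)
  fix P :: "real poly"
  assume P: "degree P \<le> d"
  \<comment> \<open>\<open>Q\<close> is \<open>P (x - b)\<close>, so that its phase at
    \<open>n + b\<close> is the phase of \<open>P\<close> at \<open>n\<close>.\<close>
  define Q where "Q = pcompose P [:- real b, 1:]"
  define S where "S = (\<lambda>N. \<Sum>n<N. w n * e (poly Q (of_nat n)))"
  have "degree Q \<le> d"
    unfolding Q_def using degree_pcompose_linear_le P by (rule order.trans)
  then have S: "(\<lambda>N. 1 / of_nat N * S N) \<longlonglongrightarrow> 0"
    unfolding S_def by (rule oscillating_of_orderD[OF w])
  have sum: "(\<Sum>n<N. w (n + b) * e (poly P (of_nat n))) = S (N + b) - S b" for N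
    by (induction N) (simp_all add: S_def Q_def poly_pcompose add.commute)
  have "(\<lambda>N. 1 / of_nat N * S (N + b)) \<longlonglongrightarrow> 0"
  proof (rule average_reindex_tendsto_0[OF S])
    show "filterlim (\<lambda>N. N + b) at_top sequentially"
      by (rule filterlim_add_const_nat_at_top)
    show "\<forall>\<^sub>F N in sequentially. N + b \<le> (1 + b) * N"
      using eventually_gt_at_top[of 0] by eventually_elim simp
  qed
  moreover have "(\<lambda>N. 1 / of_nat N * S b) \<longlonglongrightarrow> 0"
    by (intro tendsto_mult_left_zero lim_1_over_n)
  ultimately have "(\<lambda>N. 1 / of_nat N * S (N + b) - 1 / of_nat N * S b) \<longlonglongrightarrow> 0 - 0"
    by (rule tendsto_diff)
  then show "(\<lambda>N. 1 / of_nat N * (\<Sum>n<N. w (n + b) * e (poly P (of_nat n)))) \<longlonglongrightarrow> 0"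
    unfolding sum by (simp add: right_diff_distrib)
qed

text \<open>A geometric sum whose ratio \<open>z\<close> is an \<open>a\<close>-th root of unity,
  with \<open>z = 1\<close> exactly when \<open>a\<close> divides \<open>n\<close>.\<close>

lemma sum_characters_mod:
  assumes "a > 0"
  shows "(\<Sum>j<a. e (real j * real n / real a)) = (if a dvd n then of_nat a else 0)"
proof -
  define z where "z = e (real n / real a)"
  have pow: "e (real j * real n / real a) = z ^ j" for j
    unfolding z_def exp_of_nat_mult[symmetric] by (simp add: mult_ac)
  have z1: "z = 1 \<longleftrightarrow> a dvd n"
    using complex_root_unity_eq_1[of a n] assms by (simp add: z_def mult_ac)
  have "z ^ a = 1"
    using complex_root_unity[of a n] assms by (simp add: z_def mult_ac)
  then show ?thesis
    unfolding pow z1[symmetric] by (simp add: sum_gp_strict)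
qed

lemma sum_multiples:
  fixes f :: "nat \<Rightarrow> 'a::comm_monoid_add"
  assumes "a > 0"
  shows "(\<Sum>n<N. f (a * n)) = (\<Sum>n<a * N. if a dvd n then f n else 0)"
proof -
  have "(\<Sum>n<a * N. if a dvd n then f n else 0) = (\<Sum>n | n < a * N \<and> a dvd n. f n)"
    by (subst sum.inter_filter[symmetric]) (auto intro!: sum.cong)
  also have "\<dots> = (\<Sum>n<N. f (a * n))"
    by (rule sum.reindex_bij_witness[of _ "\<lambda>n. a * n" "\<lambda>n. n div a"])
       (use assms in \<open>auto simp: less_mult_imp_div_less mult.commute\<close>)
  finally show ?thesis ..
qed

lemma oscillating_of_order_multiples:
  assumes w: "oscillating_of_order d w" and a: "a > 0" and d: "d \<ge> 1"
  shows "oscillating_of_order d (\<lambda>n. w (a * n))"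
  unfolding oscillating_of_order_def
proof (intro allI impI)
  fix P :: "real poly"
  assume P: "degree P \<le> d"
  \<comment> \<open>At a multiple \<open>a * n\<close> the first summand returns \<open>P n\<close>;
    the second is the phase of the \<open>j\<close>-th character. It can have degree 1, which is
    where \<open>d \<ge> 1\<close> enters.\<close>
  define Q where "Q j = pcompose P [:0, 1 / real a:] + [:0, real j / real a:]" for j
  define S where "S j N = (\<Sum>n<N. w n * e (poly (Q j) (of_nat n)))" for j N
  have "degree (Q j) \<le> d" for j
    unfolding Q_def
    by (intro degree_add_le order.trans[OF degree_pcompose_linear_le P]) (use d in auto)
  then have S: "(\<lambda>N. 1 / of_nat N * S j N) \<longlonglongrightarrow> 0" for j
    unfolding S_def by (intro oscillating_of_orderD[OF w])
  have eQ: "e (poly (Q j) (real n)) = e (poly P (real n / real a)) * e (real j * real n / real a)"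
    for j n
    unfolding e_add[symmetric] by (simp add: Q_def poly_pcompose mult.commute)
  have sum: "(\<Sum>n<N. w (a * n) * e (poly P (of_nat n))) = 1 / of_nat a * (\<Sum>j<a. S j (a * N))" for N
  proof -
    have "(\<Sum>n<N. w (a * n) * e (poly P (of_nat n)))
        = (\<Sum>n<N. w (a * n) * e (poly P (real (a * n) / real a)))"
      using a by simp
    also have "\<dots> = (\<Sum>n<a * N. if a dvd n then w n * e (poly P (real n / real a)) else 0)"
      by (rule sum_multiples[OF a])
    \<comment> \<open>The indicator of \<open>a dvd n\<close> becomes the mean of the
      \<open>a\<close> characters, each absorbed into its own \<open>Q j\<close>.\<close>
    also have "\<dots> = (\<Sum>n<a * N. 1 / of_nat a * (\<Sum>j<a. w n * e (poly (Q j) (real n))))"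
      using a unfolding eQ mult.assoc[symmetric] sum_distrib_left[symmetric] sum_characters_mod[OF a]
      by (intro sum.cong) auto
    also have "\<dots> = 1 / of_nat a * (\<Sum>j<a. S j (a * N))"
      unfolding S_def by (subst sum.swap) (simp only: sum_distrib_left)
    finally show ?thesis .
  qed
  have "(\<lambda>N. 1 / of_nat N * S j (a * N)) \<longlonglongrightarrow> 0" for j
    by (rule average_reindex_tendsto_0[OF S])
       (use a in \<open>auto intro!: mult_nat_left_at_top\<close>)
  then have "(\<lambda>N. 1 / of_nat a * (\<Sum>j<a. 1 / of_nat N * S j (a * N))) \<longlonglongrightarrow> 0"
    by (intro tendsto_mult_right_zero tendsto_null_sum)
  then show "(\<lambda>N. 1 / of_nat N * (\<Sum>n<N. w (a * n) * e (poly P (of_nat n)))) \<longlonglongrightarrow> 0"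
    unfolding sum sum_distrib_left[symmetric] by (simp only: mult.left_commute)
qed

text \<open>The class of \<^term>\<open>b\<close> modulo \<^term>\<open>a\<close> has \<^term>\<open>(N + (a - 1 - b)) div a\<close> members below \<^term>\<open>N\<close>.\<close>

lemma sum_residue_classes:
  fixes f :: "nat \<Rightarrow> 'a::comm_monoid_add"
  assumes "a > 0"
  shows "(\<Sum>n<N. f n) = (\<Sum>b<a. \<Sum>n<(N + (a - 1 - b)) div a. f (a * n + b))"
proof -
  define k where "k b = (N + (a - 1 - b)) div a" for b
  have iff: "n < k b \<longleftrightarrow> a * n + b < N" if "b < a" for b n
  proof -
    have "n < k b \<longleftrightarrow> Suc n * a \<le> N + (a - 1 - b)"
      using assms by (simp only: k_def Suc_le_eq[symmetric] less_eq_div_iff_mult_less_eq)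
    \<comment> \<open>As \<open>b < a\<close>, the subtraction \<open>a - 1 - b\<close> is not
      truncated, and cancelling \<open>a - 1\<close> leaves
      \<open>a * n + b + 1 \<le> N\<close>.\<close>
    also have "\<dots> \<longleftrightarrow> a * n + b < N"
      using that by (auto simp: mult.commute)
    finally show ?thesis .
  qed
  have "(\<Sum>b<a. \<Sum>n<k b. f (a * n + b)) = (\<Sum>(b, n)\<in>(SIGMA b:{..<a}. {..<k b}). f (a * n + b))"
    by (rule sum.Sigma) auto
  also have "\<dots> = (\<Sum>n<N. f n)"
    \<comment> \<open>Division with remainder by \<open>a\<close> matches the indices below
      \<open>N\<close> with the pairs of residue and quotient.\<close>
    by (rule sum.reindex_bij_witness[of _ "\<lambda>n. (n mod a, n div a)" "\<lambda>(b, n). a * n + b"])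
       (use assms iff in auto)
  finally show ?thesis
    unfolding k_def ..
qed

lemma oscillating_of_order_if_residue_classes:
  assumes w: "\<And>b. b < a \<Longrightarrow> oscillating_of_order d (\<lambda>n. w (a * n + b))" and a: "a > 0"
  shows "oscillating_of_order d w"
  unfolding oscillating_of_order_def
proof (intro allI impI)
  fix P :: "real poly"
  assume P: "degree P \<le> d"
  \<comment> \<open>\<open>Q b\<close> is \<open>P (a * x + b)\<close>: its phase at
    \<open>n\<close> is that of \<open>P\<close> at the \<open>n\<close>-th member of the
    class.\<close>
  define Q where "Q b = pcompose P [:real b, real a:]" for b
  define S where "S b N = (\<Sum>n<N. w (a * n + b) * e (poly (Q b) (of_nat n)))" for b N
  define k where "k b N = (N + (a - 1 - b)) div a" for b N
  have "degree (Q b) \<le> d" for b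
    unfolding Q_def using degree_pcompose_linear_le P by (rule order.trans)
  then have S: "(\<lambda>N. 1 / of_nat N * S b N) \<longlonglongrightarrow> 0" if "b < a" for b
    unfolding S_def by (intro oscillating_of_orderD[OF w[OF that]])
  have sum: "(\<Sum>n<N. w n * e (poly P (of_nat n))) = (\<Sum>b<a. S b (k b N))" for N
    by (subst sum_residue_classes[OF a])
       (simp add: S_def Q_def k_def poly_pcompose algebra_simps)
  have "(\<lambda>N. 1 / of_nat N * S b (k b N)) \<longlonglongrightarrow> 0" if "b < a" for b
  proof (rule average_reindex_tendsto_0[OF S[OF that]])
    show "filterlim (k b) at_top sequentially"
      unfolding filterlim_at_top
    proof
      fix Z
      show "\<forall>\<^sub>F N in sequentially. Z \<le> k b N"
        using eventually_ge_at_top[of "Z * a"]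
        by eventually_elim (use a in \<open>simp add: k_def less_eq_div_iff_mult_less_eq\<close>)
    qed
    show "\<forall>\<^sub>F N in sequentially. k b N \<le> 1 * N"
      using eventually_gt_at_top[of 0]
    proof eventually_elim
      case (elim N)
      \<comment> \<open>From \<open>N \<le> N * a\<close> and \<open>a - 1 - b < a\<close>; hence
        the quotient by \<open>a\<close> stays below \<open>Suc N\<close>, and the constant
        \<open>C = 1\<close> suffices.\<close>
      have "N + (a - 1 - b) < Suc N * a"
        using a elim by (cases a) auto
      then show ?case
        by (simp add: k_def less_mult_imp_div_less flip: less_Suc_eq_le)
    qed
  qed
  then have "(\<lambda>N. \<Sum>b<a. 1 / of_nat N * S b (k b N)) \<longlonglongrightarrow> 0"
    by (intro tendsto_null_sum) auto
  then show "(\<lambda>N. 1 / of_nat N * (\<Sum>n<N. w n * e (poly P (of_nat n)))) \<longlonglongrightarrow> 0"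
    unfolding sum sum_distrib_left .
qed

theorem theorem1p4:
  fixes a d :: nat and w :: "nat \<Rightarrow> complex"
  assumes "a \<ge> 2" and "d \<ge> 1"
  shows "oscillating_of_order d w \<longleftrightarrow>
    (\<forall>b::nat. oscillating_of_order d (\<lambda>n. w (a * n + b)))"
proof
  assume w: "oscillating_of_order d w"
  show "\<forall>b. oscillating_of_order d (\<lambda>n. w (a * n + b))"
  proof
    fix b
    show "oscillating_of_order d (\<lambda>n. w (a * n + b))"
      \<comment> \<open>Shift first, then dilate: the multiples of \<open>a\<close> in the sequence
        shifted by \<open>b\<close> are the indices \<open>a * n + b\<close> of
        \<open>w\<close>.\<close>
      by (rule oscillating_of_order_multiples[where w = "\<lambda>n. w (n + b)"])
         (use assms in \<open>simp_all add: oscillating_of_order_shift[OF w]\<close>)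
  qed
next
  assume "\<forall>b. oscillating_of_order d (\<lambda>n. w (a * n + b))"
  then show "oscillating_of_order d w"
    using assms by (intro oscillating_of_order_if_residue_classes[of a d w]) simp_all
qed

end
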